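(* Let $T$ be a full binary reduction tree with leaf values $p=(p_1,\dots,p_k)^\top\in\mathbb R^k$, evaluated under the conditionally unbiased rounding model described in the context. For each node $v$ put $V_v=\mathbb E_\xi[e_v^2\mid p]$, where $e_v=\widehat q_v-q_v$ is the accumulated error at $v$. Then a pure summation leaf $i$ has $V_i=0$, a rounded product leaf $i$ has $V_i=\mathbb E_\xi[(\xi_i^{(p)})^2\mid p_i]$, and every internal node $v$ with children $v_1,v_2$ satisfies $$V_v=V_{v_1}+V_{v_2}+\mathbb E_\xi[\psi_v(x_v)\mid p].$$
   Context: $T$ is a full binary tree (every internal node has exactly two children) with $k$ leaves; leaf $i$ carries the exact real value $p_i$. For a node $v$, $\mathcal L(v)$ is the set of leaves at or below $v$, $q_v=\sum_{i\in\mathcal L(v)}p_i$ is the exact partial sum, $\widehat q_v$ is the computed value, and $e_v=\widehat q_v-q_v$. $\mathbb E_\xi[\cdot\mid p]$ denotes expectation over the rounding variables for fixed $p$. Conditionally unbiased rounding model. At each internal node $v$ with children $v_1,v_2$ there is a possibly random rounding map $\operatorname{fl}_v$. The pre-rounding value is $x_v=\widehat q_{v_1}+\widehat q_{v_2}=q_v+e_{v_1}+e_{v_2}$, the computed value is $\widehat q_v=\operatorname{fl}_v(x_v)$, and the local error is $\xi_v=\operatorname{fl}_v(x_v)-x_v$, so that $e_v=e_{v_1}+e_{v_2}+\xi_v$. Let $\mathcal F_v^-$ be the $\sigma$-algebra generated by the fixed input $p$ and all rounding draws in the two child subtrees of $v$ (excluding the draw at $v$); $x_v$ is $\mathcal F_v^-$-measurable.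 It is assumed that $$\mathbb E_\xi[\xi_v\mid\mathcal F_v^-]=0,\qquad \mathbb E_\xi[\xi_v^2\mid\mathcal F_v^-]=\psi_v(x_v)\ge 0,$$ where $\psi_v$ is a node-dependent function ($\psi_v(x)$ is the conditional local variance for operand $x$). Rounding draws in disjoint subtrees are independent conditional on $p$. A leaf is either a pure summation leaf, with $\widehat q_i=p_i$, or a rounded product leaf, with $\widehat q_i=p_i+\xi_i^{(p)}$, where the product rounding error $\xi_i^{(p)}$ satisfies $\mathbb E_\xi[\xi_i^{(p)}\mid p_i]=0$; product rounding errors are independent across leaves given $p$ and independent of the later accumulation draws. All rounding errors have finite second moments. *)

theory Defs
  imports "HOL-Probability.Probability"
begin

text \<open>
  Full binary trees with labelled leaves. A node of a tree is identified with the subtree rooted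
  at it. When no leaf label is repeated, distinct nodes carry distinct subtrees, so that families
  indexed by nodes can be rendered as functions on trees.
\<close>

datatype 'i rtree = Lf 'i | Br "'i rtree" "'i rtree"

fun leaf_list :: "'i rtree \<Rightarrow> 'i list" where
  "leaf_list (Lf i) = [i]"
| "leaf_list (Br l r) = leaf_list l @ leaf_list r"

definition leaves :: "'i rtree \<Rightarrow> 'i set" where
  "leaves v = set (leaf_list v)"

fun nodes :: "'i rtree \<Rightarrow> 'i rtree set" where
  "nodes (Lf i) = {Lf i}"
| "nodes (Br l r) = insert (Br l r) (nodes l \<union> nodes r)"

definition internal_nodes :: "'i rtree \<Rightarrow> 'i rtree set" where
  "internal_nodes v = {w \<in> nodes v. \<exists>l r. w = Br l r}"

text \<open>
  The probability space \<open>M\<close> carries the rounding variables only. The input \<open>p\<close> is a fixed vector,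
  so the expectation given \<open>p\<close> is the plain expectation under \<open>M\<close>. The set \<open>R\<close> consists of the
  rounded product leaves, with rounding errors \<open>\<eta> i\<close>; all other leaves are pure summation leaves.
  The random rounding map at an internal node \<open>v\<close> is \<open>\<lambda>x. fl v (draw v \<omega>) x\<close>, where \<open>draw v\<close> is
  the rounding draw at \<open>v\<close>, with values in the measurable space \<open>D v\<close>.
\<close>

locale reduction =
  fixes M :: "'w measure"
    and p :: "real ^ 'i::finite"
    and R :: "'i set"
    and \<eta> :: "'i \<Rightarrow> 'w \<Rightarrow> real"
    and D :: "'i rtree \<Rightarrow> 'd measure"
    and draw :: "'i rtree \<Rightarrow> 'w \<Rightarrow> 'd"
    and fl :: "'i rtree \<Rightarrow> 'd \<Rightarrow> real \<Rightarrow> real"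
begin

definition exact :: "'i rtree \<Rightarrow> real" where
  "exact v = (\<Sum>i\<in>leaves v. p $ i)"

fun computed :: "'i rtree \<Rightarrow> 'w \<Rightarrow> real" where
  "computed (Lf i) \<omega> = (if i \<in> R then p $ i + \<eta> i \<omega> else p $ i)"
| "computed (Br l r) \<omega> = fl (Br l r) (draw (Br l r) \<omega>) (computed l \<omega> + computed r \<omega>)"

definition err :: "'i rtree \<Rightarrow> 'w \<Rightarrow> real" where
  "err v \<omega> = computed v \<omega> - exact v"

text \<open>The pre-rounding value and the local error at the internal node \<open>Br l r\<close>.\<close>

definition operand :: "'i rtree \<Rightarrow> 'i rtree \<Rightarrow> 'w \<Rightarrow> real" where
  "operand l r \<omega> = computed l \<omega> + computed r \<omega>"

definition local_err :: "'i rtree \<Rightarrow> 'i rtree \<Rightarrow> 'w \<Rightarrow> real" where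
  "local_err l r \<omega> = fl (Br l r) (draw (Br l r) \<omega>) (operand l r \<omega>) - operand l r \<omega>"

definition err_var :: "'i rtree \<Rightarrow> real" where
  "err_var v = (\<integral>\<omega>. (err v \<omega>)\<^sup>2 \<partial>M)"

fun node_events :: "'i rtree \<Rightarrow> 'w set set" where
  "node_events (Lf i) =
     (if i \<in> R then {\<eta> i -` B \<inter> space M |B. B \<in> sets borel} else {})"
| "node_events (Br l r) =
     {draw (Br l r) -` A \<inter> space M |A. A \<in> sets (D (Br l r))}"

text \<open>The \<open>\<sigma>\<close>-algebra generated by all rounding draws, product rounding errors included, at the
  nodes in \<open>S\<close>. The fixed input contributes nothing to it.\<close>

definition draw_sigma :: "'i rtree set \<Rightarrow> 'w measure" where
  "draw_sigma S = sigma (space M) (\<Union>v\<in>S. node_events v)"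

end

text \<open>
  The instance of \<open>draw_sigma\<close> in the assumptions \<open>unbiased\<close> and \<open>variance\<close> is the
  \<open>\<sigma>\<close>-algebra of all draws in the two child subtrees, without the draw at the node itself.
\<close>

locale cond_unbiased_rounding = prob_space M + reduction M p R \<eta> D draw fl
  for M :: "'w measure"
    and p :: "real ^ 'i::finite"
    and R :: "'i set"
    and \<eta> :: "'i \<Rightarrow> 'w \<Rightarrow> real"
    and D :: "'i rtree \<Rightarrow> 'd measure"
    and draw :: "'i rtree \<Rightarrow> 'w \<Rightarrow> 'd"
    and fl :: "'i rtree \<Rightarrow> 'd \<Rightarrow> real \<Rightarrow> real" +
  fixes T :: "'i rtree"
    and \<psi> :: "'i rtree \<Rightarrow> real \<Rightarrow> real"
  assumes distinct_leaves: "distinct (leaf_list T)"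
    and all_leaves: "leaves T = UNIV"
    and draw_measurable:
      "\<And>v. v \<in> internal_nodes T \<Longrightarrow> draw v \<in> measurable M (D v)"
    and fl_measurable:
      "\<And>v. v \<in> internal_nodes T \<Longrightarrow>
        (\<lambda>(d, x). fl v d x) \<in> borel_measurable (D v \<Otimes>\<^sub>M borel)"
    and psi_measurable:
      "\<And>v. v \<in> internal_nodes T \<Longrightarrow> \<psi> v \<in> borel_measurable borel"
    and prod_measurable:
      "\<And>i. i \<in> R \<Longrightarrow> \<eta> i \<in> borel_measurable M"
    and local_err_square_integrable:
      "\<And>l r. Br l r \<in> nodes T \<Longrightarrow> integrable M (\<lambda>\<omega>. (local_err l r \<omega>)\<^sup>2)"
    and prod_square_integrable:
      "\<And>i. i \<in> R \<Longrightarrow> integrable M (\<lambda>\<omega>. (\<eta> i \<omega>)\<^sup>2)"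
    and unbiased:
      "\<And>l r. Br l r \<in> nodes T \<Longrightarrow>
        AE \<omega> in M. real_cond_exp M (draw_sigma (nodes l \<union> nodes r)) (local_err l r) \<omega> = 0"
    and variance:
      "\<And>l r. Br l r \<in> nodes T \<Longrightarrow>
        AE \<omega> in M. real_cond_exp M (draw_sigma (nodes l \<union> nodes r))
                       (\<lambda>\<omega>'. (local_err l r \<omega>')\<^sup>2) \<omega> = \<psi> (Br l r) (operand l r \<omega>)
                   \<and> \<psi> (Br l r) (operand l r \<omega>) \<ge> 0"
    and prod_unbiased:
      "\<And>i. i \<in> R \<Longrightarrow> expectation (\<eta> i) = 0"
    and indep_disjoint_subtrees:
      "\<And>v w. v \<in> nodes T \<Longrightarrow> w \<in> nodes T \<Longrightarrow> nodes v \<inter> nodes w = {} \<Longrightarrow>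
        indep_set (sets (draw_sigma (nodes v))) (sets (draw_sigma (nodes w)))"
    and prod_indep:
      "indep_vars (\<lambda>_. borel) \<eta> R"
    and prod_indep_accumulation:
      "indep_set (sets (draw_sigma (Lf ` R))) (sets (draw_sigma (internal_nodes T)))"

end

theory Submission
  imports Defs
begin

text \<open>
  Write \<open>e\<^sub>v = e\<^sub>l + e\<^sub>r + \<xi>\<^sub>v\<close> and expand the square. By induction on the tree each accumulated
  error has mean zero, so the two children's errors, being independent, are orthogonal. Both are
  measurable with respect to the draws below \<open>v\<close>, given which \<open>\<xi>\<^sub>v\<close> has mean zero, so \<open>\<xi>\<^sub>v\<close> is
  orthogonal to their sum.
\<close>

section \<open>Nodes and leaf sets of full binary trees\<close>

lemma leaf_list_nonempty: "leaf_list v \<noteq> []"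
  by (induction v) auto

lemma leaves_Br [simp]: "leaves (Br l r) = leaves l \<union> leaves r"
  by (simp add: leaves_def)

lemma leaves_nonempty: "leaves v \<noteq> {}"
  by (simp add: leaves_def leaf_list_nonempty)

lemma leaves_mono_nodes: "w \<in> nodes v \<Longrightarrow> leaves w \<subseteq> leaves v"
  by (induction v) auto

lemma self_in_nodes: "v \<in> nodes v"
  by (cases v) auto

lemma nodes_trans: "w \<in> nodes v \<Longrightarrow> v \<in> nodes u \<Longrightarrow> w \<in> nodes u"
  by (induction u) auto

lemma distinct_leaf_list_node:
  "w \<in> nodes v \<Longrightarrow> distinct (leaf_list v) \<Longrightarrow> distinct (leaf_list w)"
  by (induction v) auto

text \<open>A common node would carry all its leaves, hence at least one, into both leaf sets. This
  turns distinct leaf labels into the premise of \<open>indep_disjoint_subtrees\<close>.\<close>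

lemma nodes_disjoint:
  assumes "leaves l \<inter> leaves r = {}"
  shows "nodes l \<inter> nodes r = {}"
proof (rule equals0I)
  fix w assume "w \<in> nodes l \<inter> nodes r"
  then have "leaves w \<subseteq> leaves l \<inter> leaves r"
    using leaves_mono_nodes by blast
  then show False using assms leaves_nonempty[of w] by blast
qed

text \<open>Domination by the sum of the squares. This supplies integrability of every cross term in
  the expanded square of an error.\<close>

lemma integrable_mult_square:
  fixes f g :: "'a \<Rightarrow> real"
  assumes "f \<in> borel_measurable M" "g \<in> borel_measurable M"
    and "integrable M (\<lambda>\<omega>. (f \<omega>)\<^sup>2)" "integrable M (\<lambda>\<omega>. (g \<omega>)\<^sup>2)"
  shows "integrable M (\<lambda>\<omega>. f \<omega> * g \<omega>)"
proof (rule Bochner_Integration.integrable_bound)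
  show "integrable M (\<lambda>\<omega>. (f \<omega>)\<^sup>2 + (g \<omega>)\<^sup>2)" using assms by simp
  have "\<bar>a * b\<bar> \<le> a\<^sup>2 + b\<^sup>2" for a b :: real
    \<comment> \<open>The first fact bounds twice the product of the absolute values; nonnegativity
      of that product allows the factor 2 to be dropped.\<close>
    using sum_squares_bound[of "\<bar>a\<bar>" "\<bar>b\<bar>"] mult_nonneg_nonneg[of "\<bar>a\<bar>" "\<bar>b\<bar>"]
    unfolding abs_mult power2_abs by linarith
  then show "AE \<omega> in M. norm (f \<omega> * g \<omega>) \<le> norm ((f \<omega>)\<^sup>2 + (g \<omega>)\<^sup>2)"
    by (simp add: order_trans[OF _ abs_ge_self])
qed (use assms in simp)

section \<open>Sigma-algebras generated by rounding draws\<close>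

lemma (in reduction) space_draw_sigma [simp]: "space (draw_sigma S) = space M"
  by (simp add: draw_sigma_def space_measure_of_conv)

lemma (in reduction) node_events_Pow: "node_events v \<subseteq> Pow (space M)"
  by (cases v) auto

lemma (in reduction) sets_draw_sigma:
  "sets (draw_sigma S) = sigma_sets (space M) (\<Union>v\<in>S. node_events v)"
  unfolding draw_sigma_def using node_events_Pow by (intro sets_measure_of) blast

lemma (in reduction) sets_draw_sigma_mono:
  "S \<subseteq> S' \<Longrightarrow> sets (draw_sigma S) \<subseteq> sets (draw_sigma S')"
  unfolding sets_draw_sigma by (intro sigma_sets_mono') blast

lemma (in reduction) node_events_draw_sigma:
  "v \<in> S \<Longrightarrow> A \<in> node_events v \<Longrightarrow> A \<in> sets (draw_sigma S)"
  unfolding sets_draw_sigma by blast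

lemma (in reduction) measurable_draw_sigma_mono:
  assumes "f \<in> measurable (draw_sigma S) N" "S \<subseteq> S'"
  shows "f \<in> measurable (draw_sigma S') N"
  using assms sets_draw_sigma_mono[OF assms(2)] by (auto simp: measurable_def)

section \<open>Measurability with respect to the draws of a subtree\<close>

context cond_unbiased_rounding
begin

lemma children_in_nodes:
  assumes "Br l r \<in> nodes T"
  shows "l \<in> nodes T" "r \<in> nodes T"
  by (rule nodes_trans[OF _ assms], simp add: self_in_nodes)+

lemma nodes_subset: "v \<in> nodes T \<Longrightarrow> nodes v \<subseteq> nodes T"
  by (rule subsetI) (rule nodes_trans)

lemma nodes_children_subset:
  assumes "Br l r \<in> nodes T"
  shows "nodes l \<union> nodes r \<subseteq> nodes T"
  by (intro Un_least nodes_subset children_in_nodes[OF assms])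

lemma Br_internal: "Br l r \<in> nodes T \<Longrightarrow> Br l r \<in> internal_nodes T"
  by (simp add: internal_nodes_def)

lemma leaves_children_disjoint:
  assumes "Br l r \<in> nodes T"
  shows "leaves l \<inter> leaves r = {}"
  using distinct_leaf_list_node[OF assms distinct_leaves] by (simp add: leaves_def)

text \<open>The generating events are preimages under random variables. The restriction to nodes of
  \<open>T\<close> reflects that \<open>draw\<close> is assumed measurable only there.\<close>

lemma subalgebra_draw_sigma:
  assumes "S \<subseteq> nodes T"
  shows "subalgebra M (draw_sigma S)"
proof -
  have "node_events v \<subseteq> sets M" if "v \<in> nodes T" for v
  proof (cases v)
    case (Lf i)
    then show ?thesis using prod_measurable by (auto intro: measurable_sets)
  next
    case (Br l r)
    then show ?thesis using draw_measurable[OF Br_internal] that by (auto intro: measurable_sets)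
  qed
  then have "(\<Union>v\<in>S. node_events v) \<subseteq> sets M" using assms by blast
  then show ?thesis
    unfolding subalgebra_def sets_draw_sigma by (simp add: sets.sigma_sets_subset)
qed

lemma draw_measurable_draw_sigma:
  assumes "Br l r \<in> nodes T" "Br l r \<in> S"
  shows "draw (Br l r) \<in> measurable (draw_sigma S) (D (Br l r))"
proof (rule measurableI)
  show "draw (Br l r) x \<in> space (D (Br l r))" if "x \<in> space (draw_sigma S)" for x
    using that measurable_space[OF draw_measurable[OF Br_internal[OF assms(1)]]] by simp
  show "draw (Br l r) -` A \<inter> space (draw_sigma S) \<in> sets (draw_sigma S)"
    if "A \<in> sets (D (Br l r))" for A
    by (rule node_events_draw_sigma[OF assms(2)]) (use that in auto)
qed

lemma eta_measurable_draw_sigma: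
  assumes "i \<in> R" "Lf i \<in> S"
  shows "\<eta> i \<in> borel_measurable (draw_sigma S)"
proof (rule measurableI)
  show "\<eta> i -` A \<inter> space (draw_sigma S) \<in> sets (draw_sigma S)" if "A \<in> sets borel" for A
    by (rule node_events_draw_sigma[OF assms(2)]) (use that assms(1) in auto)
qed simp

text \<open>By induction: the children's values stay measurable for the larger sigma-algebra, which
  also contains the draw at the node itself, and the rounding map is jointly measurable in draw and
  operand.\<close>

lemma computed_measurable:
  "v \<in> nodes T \<Longrightarrow> computed v \<in> borel_measurable (draw_sigma (nodes v))"
proof (induction v)
  case (Lf i)
  then show ?case
    using eta_measurable_draw_sigma[of i "nodes (Lf i)"] by (cases "i \<in> R") auto
next
  case (Br l r)
  let ?F = "draw_sigma (nodes (Br l r))"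
  have [measurable]: "computed l \<in> borel_measurable ?F" "computed r \<in> borel_measurable ?F"
    using Br.IH children_in_nodes[OF Br.prems] by (auto elim: measurable_draw_sigma_mono)
  have [measurable]: "draw (Br l r) \<in> measurable ?F (D (Br l r))"
    using Br.prems by (intro draw_measurable_draw_sigma) auto
  have [measurable]: "(\<lambda>(d, x). fl (Br l r) d x) \<in> borel_measurable (D (Br l r) \<Otimes>\<^sub>M borel)"
    using Br.prems by (intro fl_measurable Br_internal)
  \<comment> \<open>The pair form exhibits the computed value as a composition with the uncurried
    map of \<open>fl_measurable\<close>.\<close>
  have "(\<lambda>\<omega>. case (draw (Br l r) \<omega>, computed l \<omega> + computed r \<omega>) of (d, x) \<Rightarrow> fl (Br l r) d x)
      \<in> borel_measurable ?F"
    by measurable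
  then show ?case by (simp cong: measurable_cong)
qed

lemma err_measurable:
  "v \<in> nodes T \<Longrightarrow> err v \<in> borel_measurable (draw_sigma (nodes v))"
  unfolding err_def[abs_def] using computed_measurable by simp

lemma err_random_variable:
  assumes "v \<in> nodes T"
  shows "err v \<in> borel_measurable M"
  by (rule measurable_from_subalg[OF subalgebra_draw_sigma[OF nodes_subset] err_measurable])
    (fact assms)+

section \<open>Error recursion and independence of sibling errors\<close>

lemma exact_Br: "Br l r \<in> nodes T \<Longrightarrow> exact (Br l r) = exact l + exact r"
  using leaves_children_disjoint by (simp add: exact_def sum.union_disjoint)

lemma err_Br:
  "Br l r \<in> nodes T \<Longrightarrow> err (Br l r) \<omega> = err l \<omega> + err r \<omega> + local_err l r \<omega>"
  by (simp add: err_def local_err_def operand_def exact_Br)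

lemma err_Br_square:
  assumes "Br l r \<in> nodes T"
  shows "(err (Br l r) \<omega>)\<^sup>2 = (err l \<omega>)\<^sup>2 + (err r \<omega>)\<^sup>2 + (local_err l r \<omega>)\<^sup>2
    + 2 * (err l \<omega> * err r \<omega>) + 2 * (err l \<omega> * local_err l r \<omega>) + 2 * (err r \<omega> * local_err l r \<omega>)"
  by (simp add: err_Br[OF assms] power2_eq_square algebra_simps)

lemma err_Lf: "err (Lf i) \<omega> = (if i \<in> R then \<eta> i \<omega> else 0)"
  by (simp add: err_def exact_def leaves_def)

lemma local_err_random_variable:
  assumes "Br l r \<in> nodes T"
  shows "local_err l r \<in> borel_measurable M"
proof -
  \<comment> \<open>Solving the error recursion for the local error reduces its measurability to
    that of accumulated errors.\<close>
  have "local_err l r = (\<lambda>\<omega>. err (Br l r) \<omega> - err l \<omega> - err r \<omega>)"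
    using err_Br[OF assms] by auto
  then show ?thesis
    using err_random_variable assms children_in_nodes[OF assms] by simp
qed

text \<open>Each child's error generates a sub-sigma-algebra of the draws in its own subtree, and
  independence passes to sub-sigma-algebras.\<close>

lemma indep_var_err_children:
  assumes "Br l r \<in> nodes T"
  shows "indep_var borel (err l) borel (err r)"
proof -
  have sub: "{err v -` A \<inter> space M |A. A \<in> sets borel} \<subseteq> sets (draw_sigma (nodes v))"
    if "v \<in> nodes T" for v
    using measurable_sets[OF err_measurable[OF that]] by auto
  have sub': "sigma_sets (space M) {err v -` A \<inter> space M |A. A \<in> sets borel}
      \<subseteq> sets (draw_sigma (nodes v))" if "v \<in> nodes T" for v
    using sets.sigma_sets_subset[OF sub[OF that]] by simp
  have "indep_set (sets (draw_sigma (nodes l))) (sets (draw_sigma (nodes r)))"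
    by (rule indep_disjoint_subtrees[OF children_in_nodes[OF assms]
          nodes_disjoint[OF leaves_children_disjoint[OF assms]]])
  then have "indep_set (sigma_sets (space M) {err l -` A \<inter> space M |A. A \<in> sets borel})
      (sigma_sets (space M) {err r -` A \<inter> space M |A. A \<in> sets borel})"
    unfolding indep_set_def
    by (rule indep_sets_mono_sets)
      (use sub' children_in_nodes[OF assms] in \<open>auto split: bool.split\<close>)
  then show ?thesis
    unfolding indep_var_eq using err_random_variable children_in_nodes[OF assms] by auto
qed

section \<open>Moments of local and accumulated errors\<close>

lemma integrable_local_err:
  assumes "Br l r \<in> nodes T"
  shows "integrable M (local_err l r)"
  using local_err_random_variable[OF assms] local_err_square_integrable[OF assms]
  by (rule square_integrable_imp_integrable)

text \<open>A factor known from the draws below the node can be pulled out of the conditional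
  expectation, which leaves the vanishing conditional mean of the local error.\<close>

lemma local_err_orthogonal:
  assumes T: "Br l r \<in> nodes T"
    and f: "f \<in> borel_measurable (draw_sigma (nodes l \<union> nodes r))"
    and int: "integrable M (\<lambda>\<omega>. f \<omega> * local_err l r \<omega>)"
  shows "expectation (\<lambda>\<omega>. f \<omega> * local_err l r \<omega>) = 0"
proof -
  let ?F = "draw_sigma (nodes l \<union> nodes r)"
  interpret finite_measure_subalgebra M ?F
    by unfold_locales (rule subalgebra_draw_sigma[OF nodes_children_subset[OF T]])
  have "expectation (\<lambda>\<omega>. f \<omega> * local_err l r \<omega>)
      = expectation (\<lambda>\<omega>. f \<omega> * real_cond_exp M ?F (local_err l r) \<omega>)"
    using real_cond_exp_intg(2)[OF int f local_err_random_variable[OF T]] by simp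
  also have "\<dots> = expectation (\<lambda>_. 0)"
  proof (rule integral_cong_AE)
    show "(\<lambda>\<omega>. f \<omega> * real_cond_exp M ?F (local_err l r) \<omega>) \<in> borel_measurable M"
      using measurable_from_subalg[OF subalg f] by simp
    show "AE \<omega> in M. f \<omega> * real_cond_exp M ?F (local_err l r) \<omega> = 0"
      using unbiased[OF T] by eventually_elim simp
  qed simp
  finally show ?thesis by simp
qed

lemma expectation_local_err:
  assumes "Br l r \<in> nodes T"
  shows "expectation (local_err l r) = 0"
  \<comment> \<open>Mean zero is orthogonality to the constant 1.\<close>
  using local_err_orthogonal[OF assms, of "\<lambda>_. 1"] integrable_local_err[OF assms]
  by (simp only: mult_1_left borel_measurable_const)

text \<open>Conditioning preserves the expectation, and the conditional second moment is almost
  everywhere the value of \<open>\<psi>\<close> at the operand.\<close>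

lemma expectation_local_err_square:
  assumes T: "Br l r \<in> nodes T"
  shows "expectation (\<lambda>\<omega>. (local_err l r \<omega>)\<^sup>2) = expectation (\<lambda>\<omega>. \<psi> (Br l r) (operand l r \<omega>))"
proof -
  let ?F = "draw_sigma (nodes l \<union> nodes r)"
  interpret finite_measure_subalgebra M ?F
    by unfold_locales (rule subalgebra_draw_sigma[OF nodes_children_subset[OF T]])
  have computed: "computed v \<in> borel_measurable M" if "v \<in> nodes T" for v
    by (rule measurable_from_subalg[OF subalgebra_draw_sigma[OF nodes_subset] computed_measurable])
      (fact that)+
  have "operand l r \<in> borel_measurable M"
    unfolding operand_def[abs_def]
    by (intro borel_measurable_add computed children_in_nodes[OF T])
  then have psi: "(\<lambda>\<omega>. \<psi> (Br l r) (operand l r \<omega>)) \<in> borel_measurable M"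
    using psi_measurable[OF Br_internal[OF T]] by (rule measurable_compose)
  have "expectation (real_cond_exp M ?F (\<lambda>\<omega>. (local_err l r \<omega>)\<^sup>2))
      = expectation (\<lambda>\<omega>. \<psi> (Br l r) (operand l r \<omega>))"
    using variance[OF T] psi by (intro integral_cong_AE) auto
  then show ?thesis
    unfolding real_cond_exp_int(2)[OF local_err_square_integrable[OF T]] .
qed

text \<open>Both claims share one induction: additivity of the mean at a node needs integrable child
  errors, which follows from their square integrability on a probability space.\<close>

lemma err_centered_square_integrable:
  "v \<in> nodes T \<Longrightarrow> integrable M (\<lambda>\<omega>. (err v \<omega>)\<^sup>2) \<and> expectation (err v) = 0"
proof (induction v)
  case (Lf i)
  have "err (Lf i) = (if i \<in> R then \<eta> i else (\<lambda>_. 0))"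
    by (rule ext) (simp add: err_Lf)
  then show ?case
    using prod_square_integrable[of i] prod_unbiased[of i] by (cases "i \<in> R") simp_all
next
  case (Br l r)
  note T = Br.prems and c = children_in_nodes[OF Br.prems]
  note rv = err_random_variable[OF c(1)] err_random_variable[OF c(2)]
    local_err_random_variable[OF T]
  note sq = Br.IH(1)[OF c(1), THEN conjunct1] Br.IH(2)[OF c(2), THEN conjunct1]
    local_err_square_integrable[OF T]
  have "integrable M (\<lambda>\<omega>. (err (Br l r) \<omega>)\<^sup>2)"
    using sq rv by (simp add: err_Br_square[OF T] integrable_mult_square)
  moreover have "err (Br l r) = (\<lambda>\<omega>. err l \<omega> + err r \<omega> + local_err l r \<omega>)"
    by (rule ext) (rule err_Br[OF T])
  then have "expectation (err (Br l r)) = 0"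
    using rv(1)[THEN square_integrable_imp_integrable, OF sq(1)]
      rv(2)[THEN square_integrable_imp_integrable, OF sq(2)] integrable_local_err[OF T]
      Br.IH(1)[OF c(1)] Br.IH(2)[OF c(2)] expectation_local_err[OF T]
    by simp
  ultimately show ?case by simp
qed

lemma err_var_Br:
  assumes T: "Br l r \<in> nodes T"
  shows "err_var (Br l r) = err_var l + err_var r
    + expectation (\<lambda>\<omega>. \<psi> (Br l r) (operand l r \<omega>))"
proof -
  note c = children_in_nodes[OF T]
  note rv = err_random_variable[OF c(1)] err_random_variable[OF c(2)]
    local_err_random_variable[OF T]
  note sq = err_centered_square_integrable[OF c(1), THEN conjunct1]
    err_centered_square_integrable[OF c(2), THEN conjunct1] local_err_square_integrable[OF T]
  note mult = integrable_mult_square[OF rv(1,2) sq(1,2)]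
    integrable_mult_square[OF rv(1,3) sq(1,3)] integrable_mult_square[OF rv(2,3) sq(2,3)]
  have "expectation (\<lambda>\<omega>. err l \<omega> * err r \<omega>) = expectation (err l) * expectation (err r)"
    by (rule indep_var_lebesgue_integral[OF indep_var_err_children[OF T]
          square_integrable_imp_integrable[OF rv(1) sq(1)]
          square_integrable_imp_integrable[OF rv(2) sq(2)]])
  \<comment> \<open>By independence the expectation factorizes, so one centered factor
    suffices.\<close>
  then have lr: "expectation (\<lambda>\<omega>. err l \<omega> * err r \<omega>) = 0"
    using err_centered_square_integrable[OF c(1)] by simp
  have l: "expectation (\<lambda>\<omega>. err l \<omega> * local_err l r \<omega>) = 0"
    and r: "expectation (\<lambda>\<omega>. err r \<omega> * local_err l r \<omega>) = 0"
    \<comment> \<open>Each child's error is measurable for the draws of both child subtrees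
      together, the sigma-algebra conditioned on in \<open>unbiased\<close>.\<close>
    using measurable_draw_sigma_mono[OF err_measurable[OF c(1)] Un_upper1]
      measurable_draw_sigma_mono[OF err_measurable[OF c(2)] Un_upper2] mult(2,3)
    by (auto intro: local_err_orthogonal[OF T])
  show ?thesis
    using sq mult lr l r
    by (simp add: err_var_def err_Br_square[OF T] expectation_local_err_square[OF T])
qed

end

theorem theorem2p2:
  fixes M :: "'w measure"
    and p :: "real ^ 'i::finite"
    and R :: "'i set"
    and \<eta> :: "'i \<Rightarrow> 'w \<Rightarrow> real"
    and D :: "'i rtree \<Rightarrow> 'd measure"
    and draw :: "'i rtree \<Rightarrow> 'w \<Rightarrow> 'd"
    and fl :: "'i rtree \<Rightarrow> 'd \<Rightarrow> real \<Rightarrow> real"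
    and T :: "'i rtree"
    and \<psi> :: "'i rtree \<Rightarrow> real \<Rightarrow> real"
  assumes "cond_unbiased_rounding M p R \<eta> D draw fl T \<psi>"
  shows "(\<forall>i. Lf i \<in> nodes T \<and> i \<notin> R \<longrightarrow>
            reduction.err_var M p R \<eta> draw fl (Lf i) = 0)
       \<and> (\<forall>i. Lf i \<in> nodes T \<and> i \<in> R \<longrightarrow>
            reduction.err_var M p R \<eta> draw fl (Lf i) = (\<integral>\<omega>. (\<eta> i \<omega>)\<^sup>2 \<partial>M))
       \<and> (\<forall>v1 v2. Br v1 v2 \<in> nodes T \<longrightarrow>
            reduction.err_var M p R \<eta> draw fl (Br v1 v2) =
              reduction.err_var M p R \<eta> draw fl v1 + reduction.err_var M p R \<eta> draw fl v2
              + (\<integral>\<omega>. \<psi> (Br v1 v2) (reduction.operand p R \<eta> draw fl v1 v2 \<omega>) \<partial>M))"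
proof -
  interpret cond_unbiased_rounding M p R \<eta> D draw fl T \<psi> by fact
  show ?thesis
    \<comment> \<open>The two leaf claims follow directly from \<open>err_Lf\<close>: the error
      there is the product rounding error or zero.\<close>
    using err_var_Br by (auto simp: err_var_def err_Lf)
qed

end
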